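(* Let $z_n\to z$ in $Y$ and assume that $S\colon U\to Y$ satisfies the following: (1) $u_i\rightharpoonup u$ in $U$ implies $S(u_i)\rightharpoonup S(u)$ in $Y$; (2) $S$ is Fréchet differentiable; (3) $S$ is compact; (4) for some Banach space $V$ with $U\hookrightarrow V$ and $V^*\hookrightarrow L^\infty(\Omega;\mathbb R^m)$, we have $$\lim_{\tilde u\rightharpoonup u\text{ in }U}\|[S'(\tilde u)-S'(u)]^*y\|_{V^*}=0\quad\text{for all }y\in Y$$ (at every $u\in U$). Consider the sequence of minimization problems $\min_{u\in U}\mathcal E^{z_n}(u)$. The corresponding optimal controls $u_n$ (i.e., minimizers of $\mathcal E^{z_n}$), states $y_n=S(u_n)$, and dual variables $p_n=S'(u_n)^*(z_n-y_n)$ satisfy, up to a subsequence, $$u_n\rightharpoonup\bar u\ \text{ in }U,\qquad y_n\to\bar y\ \text{ in }Y,\qquad p_n\to\bar p\ \text{ in }V^*,$$ where $\bar u$ is a minimizer of $\mathcal E^z$, $\bar y=S(\bar u)$, and $\bar p$ satisfies $$-\bar p=S'(\bar u)^*(S(\bar u)-z),\qquad \bar u\in\partial\mathcal G^*(\bar p).$$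
   Context: $\Omega\subset\mathbb R^n$ is a bounded open domain, $m\ge 2$, $U=L^2(\Omega;\mathbb R^m)$ (identified with its dual), $Y$ is a Hilbert space, and $S\colon U\to Y$ is a (possibly nonlinear) operator. $\mathcal M\subset\mathbb R^m$ is a finite set and $g\colon\mathbb R^m\to\mathbb R\cup\{\infty\}$ is proper, convex, and lower semi-continuous with $\operatorname{dom} g=\operatorname{co}\mathcal M$ (the convex hull of $\mathcal M$). For $z\in Y$ and $u\in U$, $\mathcal E^z(u)=\frac12\|S(u)-z\|_Y^2+\mathcal G(u)$ with $\mathcal G(u)=\int_\Omega g(u(x))\,\mathrm dx$. $\mathcal G^*$ is the Legendre--Fenchel conjugate of $\mathcal G$ on $U$, $\partial\mathcal G^*$ its convex subdifferential, and $S'(u)^*\colon Y\to U$ the Hilbert-space adjoint of the Fréchet derivative $S'(u)$. The symbol $\hookrightarrow$ denotes continuous embedding, $V^*$ is the dual space of $V$, $\to$ denotes strong convergence and $\rightharpoonup$ weak convergence.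
   Formalization: Hypothesis (4) is supplemented by the requirement that S'(u)^*y lies in V^* for all u in U and y in Y; otherwise, for linear S, (4) is vacuous and p_n need not lie or converge in V^*. *)

theory Defs
  imports "HOL-Analysis.Analysis"
begin

definition L2 :: "(real ^ 'n) set \<Rightarrow> (real ^ 'n \<Rightarrow> real ^ 'm) set" where
  "L2 \<Omega> = {f \<in> borel_measurable (lebesgue_on \<Omega>).
            integrable (lebesgue_on \<Omega>) (\<lambda>x. (norm (f x))\<^sup>2)}"

text \<open>
  A type cannot depend on the set \<open>\<Omega>\<close>, so the Hilbert space of almost-everywhere classes of
  \<open>L2 \<Omega>\<close> is a type \<open>'u\<close> together with a map \<open>rep\<close> choosing a representative of each class.
  The conditions say that \<open>rep\<close> induces a linear bijection of \<open>'u\<close> onto the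
  set of classes that carries the inner product of \<open>'u\<close> to the usual one; injectivity follows
  from the last condition.
\<close>

definition is_L2_space ::
    "(real ^ 'n) set \<Rightarrow> ('u::real_inner \<Rightarrow> real ^ 'n \<Rightarrow> real ^ 'm) \<Rightarrow> bool" where
  "is_L2_space \<Omega> rep \<longleftrightarrow>
     range rep \<subseteq> L2 \<Omega> \<and>
     (\<forall>f\<in>L2 \<Omega>. \<exists>u. AE x in lebesgue_on \<Omega>. rep u x = f x) \<and>
     (\<forall>u v. AE x in lebesgue_on \<Omega>. rep (u + v) x = rep u x + rep v x) \<and>
     (\<forall>c u. AE x in lebesgue_on \<Omega>. rep (c *\<^sub>R u) x = c *\<^sub>R rep u x) \<and>
     (\<forall>u v. u \<bullet> v = (\<integral>x. rep u x \<bullet> rep v x \<partial>lebesgue_on \<Omega>))"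

definition weakly_tendsto :: "(nat \<Rightarrow> 'a::real_normed_vector) \<Rightarrow> 'a \<Rightarrow> bool" where
  "weakly_tendsto X x \<longleftrightarrow>
     (\<forall>\<phi> :: 'a \<Rightarrow>\<^sub>L real. (\<lambda>i. blinfun_apply \<phi> (X i)) \<longlonglongrightarrow> blinfun_apply \<phi> x)"

definition compact_operator :: "('a::metric_space \<Rightarrow> 'b::metric_space) \<Rightarrow> bool" where
  "compact_operator S \<longleftrightarrow> (\<forall>B. bounded B \<longrightarrow> compact (closure (S ` B)))"

definition proper_fun :: "('a \<Rightarrow> ereal) \<Rightarrow> bool" where
  "proper_fun f \<longleftrightarrow> (\<forall>x. f x \<noteq> -\<infinity>) \<and> (\<exists>x. f x \<noteq> \<infinity>)"

text \<open>Since \<open>0 * \<infinity> = 0\<close> in \<^typ>\<open>ereal\<close>, the cases \<open>t = 0\<close> and \<open>t = 1\<close> are trivial.\<close>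

definition convex_fun :: "('a::real_vector \<Rightarrow> ereal) \<Rightarrow> bool" where
  "convex_fun f \<longleftrightarrow>
     (\<forall>x y. \<forall>t\<in>{0..1}. f ((1 - t) *\<^sub>R x + t *\<^sub>R y) \<le> ereal (1 - t) * f x + ereal t * f y)"

definition lower_semicontinuous :: "('a::topological_space \<Rightarrow> ereal) \<Rightarrow> bool" where
  "lower_semicontinuous f \<longleftrightarrow> (\<forall>x. f x \<le> Liminf (at x) f)"

definition effective_domain :: "('a \<Rightarrow> ereal) \<Rightarrow> 'a set" where
  "effective_domain f = {x. f x < \<infinity>}"

text \<open>
  The coercion \<^const>\<open>e2ennreal\<close> sends negative values to 0, so this is the integral of the
  positive part minus the integral of the negative part.
\<close>

definition ereal_integral :: "'a measure \<Rightarrow> ('a \<Rightarrow> ereal) \<Rightarrow> ereal" where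
  "ereal_integral M f =
     enn2ereal (\<integral>\<^sup>+ x. e2ennreal (f x) \<partial>M) - enn2ereal (\<integral>\<^sup>+ x. e2ennreal (- f x) \<partial>M)"

definition integral_functional ::
    "(real ^ 'n) set \<Rightarrow> ('u \<Rightarrow> real ^ 'n \<Rightarrow> real ^ 'm) \<Rightarrow> (real ^ 'm \<Rightarrow> ereal) \<Rightarrow> 'u \<Rightarrow> ereal" where
  "integral_functional \<Omega> rep g u = ereal_integral (lebesgue_on \<Omega>) (\<lambda>x. g (rep u x))"

definition tracking_energy ::
    "('u \<Rightarrow> 'y::real_normed_vector) \<Rightarrow> ('u \<Rightarrow> ereal) \<Rightarrow> 'y \<Rightarrow> 'u \<Rightarrow> ereal" where
  "tracking_energy S G z u = ereal (1 / 2 * (norm (S u - z))\<^sup>2) + G u"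

abbreviation is_minimizer :: "('u \<Rightarrow> ereal) \<Rightarrow> 'u \<Rightarrow> bool" where
  "is_minimizer F \<equiv> is_arg_min F (\<lambda>_. True)"

text \<open>
  Conjugate and subdifferential on a Hilbert space identified with its dual; the
  subdifferential is empty outside the effective domain.
\<close>

definition conjugate :: "('a::real_inner \<Rightarrow> ereal) \<Rightarrow> 'a \<Rightarrow> ereal" where
  "conjugate F p = (SUP u. ereal (p \<bullet> u) - F u)"

definition subdifferential :: "('a::real_inner \<Rightarrow> ereal) \<Rightarrow> 'a \<Rightarrow> 'a set" where
  "subdifferential F p =
     {u. \<bar>F p\<bar> \<noteq> \<infinity> \<and> (\<forall>q. F p + ereal (u \<bullet> (q - p)) \<le> F q)}"

definition continuous_embedding ::
    "('a::real_normed_vector \<Rightarrow> 'b::real_normed_vector) \<Rightarrow> bool" where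
  "continuous_embedding j \<longleftrightarrow> bounded_linear j \<and> inj j"

text \<open>
  For an embedding \<open>j\<close> of a Hilbert space \<open>'u\<close> into \<open>'v\<close>, a functional \<open>\<phi>\<close> on \<open>'v\<close>
  restricts to the functional \<open>\<phi> \<circ> j\<close> on \<open>'u\<close>, which is identified with its Riesz representative.
  The dual of \<open>'v\<close> is thereby viewed as a subspace of \<open>'u\<close>, and
  \<open>dual_norm j\<close> is its norm, meaningful only on \<open>dual_space j\<close>.
\<close>

definition dual_embedding ::
    "('u::real_inner \<Rightarrow> 'v::real_normed_vector) \<Rightarrow> ('v \<Rightarrow>\<^sub>L real) \<Rightarrow> 'u" where
  "dual_embedding j \<phi> = (THE w. \<forall>u. w \<bullet> u = blinfun_apply \<phi> (j u))"

definition dual_space :: "('u::real_inner \<Rightarrow> 'v::real_normed_vector) \<Rightarrow> 'u set" where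
  "dual_space j = range (dual_embedding j)"

definition dual_norm :: "('u::real_inner \<Rightarrow> 'v::real_normed_vector) \<Rightarrow> 'u \<Rightarrow> real" where
  "dual_norm j w = norm (inv (dual_embedding j) w)"

text \<open>Continuous embedding of the dual of \<open>'v\<close> into the space of essentially bounded functions.\<close>

definition dual_embeds_in_Linf ::
    "(real ^ 'n) set \<Rightarrow> ('u::real_inner \<Rightarrow> real ^ 'n \<Rightarrow> real ^ 'm) \<Rightarrow>
     ('u \<Rightarrow> 'v::real_normed_vector) \<Rightarrow> bool" where
  "dual_embeds_in_Linf \<Omega> rep j \<longleftrightarrow>
     inj (dual_embedding j) \<and>
     (\<exists>C. \<forall>\<phi>. AE x in lebesgue_on \<Omega>. norm (rep (dual_embedding j \<phi>) x) \<le> C * norm \<phi>)"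

definition tendsto_in_dual ::
    "('u::real_inner \<Rightarrow> 'v::real_normed_vector) \<Rightarrow> (nat \<Rightarrow> 'u) \<Rightarrow> 'u \<Rightarrow> bool" where
  "tendsto_in_dual j P p \<longleftrightarrow>
     range P \<subseteq> dual_space j \<and> p \<in> dual_space j \<and> (\<lambda>i. dual_norm j (P i - p)) \<longlonglongrightarrow> 0"

end

theory Submission
  imports Defs "HOL-Library.Diagonal_Subsequence"
begin

text \<open>
  Every control of finite cost takes its values in the compact set \<open>convex hull M\<close>
  almost everywhere, and \<open>\<Omega>\<close> has finite measure, so all minimizers lie in one ball of \<open>'u\<close>.
  Bounded sequences in a Hilbert space have weakly convergent subsequences
  (\<open>bounded_imp_weakly_convergent_subseq\<close>), and since \<open>S\<close> is compact a further choice makes the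
  states converge strongly; their limit is \<open>S ubar\<close> because \<open>S\<close> is weakly continuous.
  The cost \<open>G\<close> is convex and has closed sublevel sets, hence it is weakly lower semicontinuous
  (\<open>convex_closed_sublevels_weakly_lsc\<close>), and comparing \<open>us (r n)\<close> with a fixed competitor shows
  that \<open>ubar\<close> minimizes the limit problem.

  The delicate point is the convergence of the dual variables in the dual of \<open>'v\<close>. Writing
  \<open>T n = S' (us (r n))\<close>, \<open>L = S' ubar\<close> and \<open>w n = zs (r n) - S (us (r n))\<close> with limit \<open>w\<close>, the error
  splits as \<open>adjoint (T n) (w n - w) + adjoint (\<lambda>h. T n h - L h) w\<close>. The second
  summand tends to 0 by hypothesis. The first needs a bound on \<open>adjoint (T n)\<close>, as a map into the
  dual of \<open>'v\<close>, which is uniform in \<open>n\<close>; the hypotheses only say that the values lie in that dual.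
  However, these maps have closed graphs, because the dual of \<open>'v\<close> embeds injectively and
  continuously into \<open>'u\<close>, and they are pointwise bounded, because they converge pointwise. The closed
  graph theorem and the principle of uniform boundedness, merged into one Baire category argument
  (\<open>uniform_boundedness_closed_operators\<close>), then supply the bound.

  Finally, varying \<open>ubar\<close> along segments gives the variational inequality
  \<open>G ubar + pbar \<bullet> (v - ubar) \<le> G v\<close>, that is, equality in the Fenchel-Young inequality, and this
  makes \<open>ubar\<close> a subgradient of the conjugate of \<open>G\<close> at \<open>pbar\<close>.
\<close>

section \<open>Projections, adjoints and weak convergence in Hilbert spaces\<close>

text \<open>
  A minimizing sequence is Cauchy by the parallelogram law: midpoints stay in \<open>C\<close>, so their
  distance to \<open>x\<close> is at least the infimum, which leaves no room for \<open>y m\<close> and \<open>y n\<close> to differ.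
\<close>

lemma nearest_point_closed_convex:
  fixes C :: "'a::{real_inner, complete_space} set"
  assumes "closed C" "convex C" "C \<noteq> {}"
  obtains a where "a \<in> C" "\<And>y. y \<in> C \<Longrightarrow> dist x a \<le> dist x y"
proof -
  define d where "d = (INF y\<in>C. (norm (x - y))\<^sup>2)"
  have bdd: "bdd_below ((\<lambda>y. (norm (x - y))\<^sup>2) ` C)"
    by (rule bdd_belowI[of _ 0]) auto
  have d_le: "d \<le> (norm (x - y))\<^sup>2" if "y \<in> C" for y
    unfolding d_def using bdd that by (rule cINF_lower)
  have "\<exists>y\<in>C. (norm (x - y))\<^sup>2 < d + inverse (real (Suc n))" for n
  proof -
    have "d < d + inverse (real (Suc n))" by simp
    then show ?thesis
      unfolding d_def using cINF_less_iff[OF assms(3) bdd] by blast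
  qed
  then obtain y where y: "\<And>n. y n \<in> C" "\<And>n. (norm (x - y n))\<^sup>2 < d + inverse (real (Suc n))"
    by metis
  have gap: "(dist (y m) (y n))\<^sup>2 \<le> 2 * inverse (real (Suc m)) + 2 * inverse (real (Suc n))" for m n
  proof -
    let ?c = "(1/2) *\<^sub>R y m + (1/2) *\<^sub>R y n"
    have "?c \<in> C"
      using \<open>convex C\<close> y(1) by (simp add: convex_def)
    then have "d \<le> (norm (x - ?c))\<^sup>2" by (rule d_le)
    \<comment> \<open>the parallelogram law for \<open>x - y m\<close> and \<open>x - y n\<close>\<close>
    moreover have "(dist (y m) (y n))\<^sup>2 + 4 * (norm (x - ?c))\<^sup>2
        = 2 * (norm (x - y m))\<^sup>2 + 2 * (norm (x - y n))\<^sup>2"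
      by (simp add: dist_norm power2_norm_eq_inner inner_simps inner_commute algebra_simps)
    ultimately show ?thesis using y(2)[of m] y(2)[of n] by linarith
  qed
  have "Cauchy y"
  proof (rule metric_CauchyI)
    fix e :: real assume "0 < e"
    then obtain N where N: "inverse (real (Suc N)) < e\<^sup>2 / 4"
      using reals_Archimedean[of "e\<^sup>2 / 4"] by auto
    show "\<exists>M. \<forall>m\<ge>M. \<forall>n\<ge>M. dist (y m) (y n) < e"
    proof (intro exI allI impI)
      fix m n assume "N \<le> m" "N \<le> n"
      then have "inverse (real (Suc m)) \<le> inverse (real (Suc N))"
                "inverse (real (Suc n)) \<le> inverse (real (Suc N))"
        by (auto intro!: le_imp_inverse_le)
      with gap[of m n] N have "(dist (y m) (y n))\<^sup>2 < e\<^sup>2" by linarith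
      then show "dist (y m) (y n) < e"
        using \<open>0 < e\<close> by (simp add: power_less_imp_less_base)
    qed
  qed
  then obtain a where a: "y \<longlonglongrightarrow> a"
    by (auto simp: Cauchy_convergent_iff convergent_def)
  have "a \<in> C"
    using closed_sequentially[OF \<open>closed C\<close>] y(1) a by blast
  have "(norm (x - a))\<^sup>2 \<le> d"
  proof (rule LIMSEQ_le)
    show "(\<lambda>n. (norm (x - y n))\<^sup>2) \<longlonglongrightarrow> (norm (x - a))\<^sup>2"
      by (intro tendsto_intros a)
    show "(\<lambda>n. d + inverse (real (Suc n))) \<longlonglongrightarrow> d"
      using tendsto_add[OF tendsto_const LIMSEQ_inverse_real_of_nat, of d] by simp
    show "\<exists>N. \<forall>n\<ge>N. (norm (x - y n))\<^sup>2 \<le> d + inverse (real (Suc n))"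
      using y(2) less_imp_le by blast
  qed
  then have "dist x a \<le> dist x b" if "b \<in> C" for b
    unfolding dist_norm by (rule power2_le_imp_le[OF order_trans[OF _ d_le[OF that]] norm_ge_zero])
  with \<open>a \<in> C\<close> show thesis by (rule that)
qed

lemma projection_onto_closed_convex:
  fixes C :: "'a::{real_inner, complete_space} set"
  assumes "closed C" "convex C" "C \<noteq> {}"
  obtains a where "a \<in> C" "\<And>y. y \<in> C \<Longrightarrow> (x - a) \<bullet> (y - a) \<le> 0"
  using nearest_point_closed_convex[OF assms, of x] any_closest_point_dot[OF assms(2,1)] by metis

lemma orthogonal_projection_onto_closed_subspace:
  fixes C :: "'a::{real_inner, complete_space} set"
  assumes "closed C" "subspace C"
  obtains a where "a \<in> C" "\<And>y. y \<in> C \<Longrightarrow> (x - a) \<bullet> y = 0"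
proof -
  obtain a where a: "a \<in> C" "\<And>y. y \<in> C \<Longrightarrow> (x - a) \<bullet> (y - a) \<le> 0"
    using projection_onto_closed_convex[OF assms(1) subspace_imp_convex[OF assms(2)]]
      subspace_0[OF assms(2)] by blast
  have "(x - a) \<bullet> y = 0" if "y \<in> C" for y
    using a(2)[of "a + y"] a(2)[of "a - y"] a(1) that assms(2)
    by (auto simp: subspace_add subspace_diff)
  with a(1) show thesis by (rule that)
qed

text \<open>
  For \<open>f \<noteq> 0\<close>, a vector \<open>b\<close> with \<open>f b \<noteq> 0\<close> orthogonal to the kernel represents \<open>f\<close> up to a scalar,
  since the kernel and \<open>b\<close> together span the space.
\<close>

theorem riesz_representation:
  fixes f :: "'a::{real_inner, complete_space} \<Rightarrow> real"
  assumes "bounded_linear f"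
  obtains w where "\<And>x. f x = w \<bullet> x"
proof (cases "\<forall>x. f x = 0")
  case True
  then show thesis using that[of 0] by simp
next
  case False
  interpret bounded_linear f by fact
  let ?K = "{x. f x = 0}"
  have "closed ?K"
    by (intro closed_Collect_eq continuous_on_const linear_continuous_on assms)
  moreover have "subspace ?K"
    by (auto simp: subspace_def add scaleR zero)
  moreover from False obtain x where x: "f x \<noteq> 0" by blast
  ultimately obtain a where a: "f a = 0" "\<And>y. f y = 0 \<Longrightarrow> (x - a) \<bullet> y = 0"
    using orthogonal_projection_onto_closed_subspace[of ?K x] by auto
  define b where "b = x - a"
  have fb: "f b = f x" by (simp add: b_def diff a)
  then have "b \<noteq> 0" using x zero by auto
  show thesis
  proof (rule that)
    fix y
    have "f (y - (f y / f b) *\<^sub>R b) = 0"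
      using fb x by (simp add: diff scaleR)
    then have "b \<bullet> (y - (f y / f b) *\<^sub>R b) = 0"
      using a(2) unfolding b_def by blast
    then show "f y = ((f b / (b \<bullet> b)) *\<^sub>R b) \<bullet> y"
      using \<open>b \<noteq> 0\<close> fb x by (simp add: inner_diff_right field_simps)
  qed
qed

text \<open>
  The adjoint is a choice operator, so its defining property rests on the existence of some
  adjoint; by Riesz, completeness of the domain suffices for that.
\<close>

lemma adjoint_characterization:
  fixes f :: "'a::{real_inner, complete_space} \<Rightarrow> 'b::real_inner"
  assumes "bounded_linear f"
  shows "adjoint f y \<bullet> x = y \<bullet> f x"
proof -
  have "bounded_linear (\<lambda>x. f x \<bullet> y)" for y
    by (rule bounded_linear_compose[OF bounded_linear_inner_left assms])
  then have "\<exists>w. \<forall>x. f x \<bullet> y = x \<bullet> w" for y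
    by (metis riesz_representation inner_commute)
  then obtain f' where f': "\<forall>x y. f x \<bullet> y = x \<bullet> f' y" by metis
  then show ?thesis
    using adjoint_unique[OF f'] by (metis inner_commute)
qed

lemma weakly_tendsto_iff_inner:
  fixes X :: "nat \<Rightarrow> 'a::{real_inner, complete_space}"
  shows "weakly_tendsto X x \<longleftrightarrow> (\<forall>w. (\<lambda>i. w \<bullet> X i) \<longlonglongrightarrow> w \<bullet> x)"
proof
  assume *: "weakly_tendsto X x"
  show "\<forall>w. (\<lambda>i. w \<bullet> X i) \<longlonglongrightarrow> w \<bullet> x"
  proof
    fix w :: 'a
    have "bounded_linear ((\<bullet>) w)" by (rule bounded_linear_inner_right)
    then show "(\<lambda>i. w \<bullet> X i) \<longlonglongrightarrow> w \<bullet> x"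
      using *[unfolded weakly_tendsto_def, rule_format, of "Blinfun ((\<bullet>) w)"]
      by (simp add: bounded_linear_Blinfun_apply)
  qed
next
  assume *: "\<forall>w. (\<lambda>i. w \<bullet> X i) \<longlonglongrightarrow> w \<bullet> x"
  show "weakly_tendsto X x"
    unfolding weakly_tendsto_def
  proof
    fix \<phi> :: "'a \<Rightarrow>\<^sub>L real"
    obtain w where "\<And>y. blinfun_apply \<phi> y = w \<bullet> y"
      using riesz_representation blinfun.bounded_linear_right by metis
    then show "(\<lambda>i. blinfun_apply \<phi> (X i)) \<longlonglongrightarrow> blinfun_apply \<phi> x"
      using * by simp
  qed
qed

lemma weakly_tendsto_subseq:
  "weakly_tendsto X x \<Longrightarrow> strict_mono r \<Longrightarrow> weakly_tendsto (X \<circ> r) x"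
  unfolding weakly_tendsto_def by (auto simp: o_def dest: LIMSEQ_subseq_LIMSEQ[unfolded o_def])

text \<open>
  The variational inequality for the projection \<open>a\<close> of the weak limit \<open>x\<close> is linear in the points of
  \<open>C\<close>, so it survives the weak limit and forces \<open>x = a\<close>.
\<close>

lemma weak_limit_in_closed_convex:
  fixes X :: "nat \<Rightarrow> 'a::{real_inner, complete_space}"
  assumes "closed C" "convex C" "weakly_tendsto X x" "\<And>n. X n \<in> C"
  shows "x \<in> C"
proof -
  obtain a where a: "a \<in> C" "\<And>y. y \<in> C \<Longrightarrow> (x - a) \<bullet> (y - a) \<le> 0"
    using projection_onto_closed_convex[OF assms(1,2)] assms(4) by blast
  have "(\<lambda>n. (x - a) \<bullet> X n - (x - a) \<bullet> a) \<longlonglongrightarrow> (x - a) \<bullet> x - (x - a) \<bullet> a"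
    using assms(3) by (intro tendsto_diff tendsto_const) (simp add: weakly_tendsto_iff_inner)
  then have "(x - a) \<bullet> x - (x - a) \<bullet> a \<le> 0"
    by (rule LIMSEQ_le_const2) (use a(2)[OF assms(4)] in \<open>auto simp: inner_diff_right\<close>)
  then have "(x - a) \<bullet> (x - a) \<le> 0" by (simp only: inner_diff_right)
  then have "x = a" using inner_ge_zero[of "x - a"] by (simp add: antisym)
  with a(1) show ?thesis by simp
qed

text \<open>
  A diagonal subsequence makes all the scalar sequences \<open>X k \<bullet> X (r n)\<close> converge. The vectors \<open>y\<close> for
  which \<open>y \<bullet> X (r n)\<close> converges form a closed subspace that contains every \<open>X k\<close>, and also
  everything orthogonal to it, where the scalar sequences vanish; hence it is the whole space. The
  limit is a bounded functional of \<open>y\<close>, represented by the weak limit.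
\<close>

theorem bounded_imp_weakly_convergent_subseq:
  fixes X :: "nat \<Rightarrow> 'a::{real_inner, complete_space}"
  assumes B: "\<And>n. norm (X n) \<le> B"
  obtains x r where "strict_mono r" "weakly_tendsto (X \<circ> r) x"
proof -
  have B0: "0 \<le> B" using B[of 0] norm_ge_zero order_trans by blast
  define P where "P = (\<lambda>k s. convergent (\<lambda>n. X k \<bullet> X (s n)))"
  interpret subseqs P
  proof
    fix k and s :: "nat \<Rightarrow> nat"
    have "norm (X k \<bullet> X (s n)) \<le> B * B" for n
      by (rule order_trans[OF Cauchy_Schwarz_ineq2[folded real_norm_def] mult_mono]) (use B B0 in auto)
    then have "bounded (range (\<lambda>n. X k \<bullet> X (s n)))"
      by (auto simp: bounded_iff)
    then obtain l r where "strict_mono r" "((\<lambda>n. X k \<bullet> X (s n)) \<circ> r) \<longlonglongrightarrow> l"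
      using bounded_imp_convergent_subsequence by blast
    then show "\<exists>r. strict_mono r \<and> P k (s \<circ> r)"
      by (auto simp: P_def o_def convergent_def)
  qed
  define r where "r = diagseq"
  have r: "strict_mono r" unfolding r_def by (rule subseq_diagseq)
  define D where "D = {y. convergent (\<lambda>n. y \<bullet> X (r n))}"
  have XD: "X k \<in> D" for k
  proof -
    have "P k (r \<circ> ((+) (Suc k)))"
      unfolding r_def
    proof (rule diagseq_holds)
      fix r s :: "nat \<Rightarrow> nat" and n assume "strict_mono r" "P n s"
      then show "P n (s \<circ> r)"
        unfolding P_def using convergent_subseq_convergent[of "\<lambda>i. X n \<bullet> X (s i)" r]
        by (simp add: o_def)
    qed
    then show ?thesis
      unfolding P_def D_def
      using convergent_ignore_initial_segment[of "\<lambda>n. X k \<bullet> X (r n)" "Suc k"]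
      by (simp add: o_def add.commute)
  qed
  have D_sub: "subspace D"
    by (auto simp: subspace_def D_def inner_add_left convergent_const
        intro: convergent_add convergent_mult[OF convergent_const])
  have D_closed: "closed D"
    unfolding closed_sequential_limits
  proof (intro allI impI, elim conjE)
    fix y l assume y: "\<forall>n. y n \<in> D" and yl: "y \<longlonglongrightarrow> l"
    have "Cauchy (\<lambda>n. l \<bullet> X (r n))"
    proof (rule metric_CauchyI)
      fix e :: real assume "0 < e"
      define e' where "e' = e / (3 * (B + 1))"
      have e': "0 < e'" "e' * B < e / 3"
        using \<open>0 < e\<close> B0 by (auto simp: e'_def field_simps)
      obtain k where k: "dist (y k) l < e'"
        using yl e'(1) by (meson LIMSEQ_iff_nz lim_sequentially order_refl)
      have near: "\<bar>l \<bullet> X (r n) - y k \<bullet> X (r n)\<bar> < e / 3" for n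
      proof -
        have "\<bar>(l - y k) \<bullet> X (r n)\<bar> \<le> norm (l - y k) * norm (X (r n))"
          by (rule Cauchy_Schwarz_ineq2)
        also have "\<dots> \<le> e' * B"
          using k B e' by (intro mult_mono) (auto simp: dist_norm norm_minus_commute)
        finally show ?thesis using e'(2) by (simp add: inner_diff_left)
      qed
      have "Cauchy (\<lambda>n. y k \<bullet> X (r n))"
        using y by (simp add: D_def Cauchy_convergent_iff)
      then obtain N where N: "\<And>m n. m \<ge> N \<Longrightarrow> n \<ge> N \<Longrightarrow> dist (y k \<bullet> X (r m)) (y k \<bullet> X (r n)) < e / 3"
        using \<open>0 < e\<close> unfolding Cauchy_def by (metis divide_pos_pos zero_less_numeral)
      show "\<exists>N. \<forall>m\<ge>N. \<forall>n\<ge>N. dist (l \<bullet> X (r m)) (l \<bullet> X (r n)) < e"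
      proof (intro exI allI impI)
        fix m n assume "N \<le> m" "N \<le> n"
        then show "dist (l \<bullet> X (r m)) (l \<bullet> X (r n)) < e"
          using N[of m n] near[of m] near[of n] unfolding dist_real_def by linarith
      qed
    qed
    then show "l \<in> D" by (simp add: D_def Cauchy_convergent_iff)
  qed
  have D_UNIV: "y \<in> D" for y
  proof -
    obtain a where a: "a \<in> D" "\<And>x. x \<in> D \<Longrightarrow> (y - a) \<bullet> x = 0"
      using orthogonal_projection_onto_closed_subspace[OF D_closed D_sub] by blast
    have "y - a \<in> D" using a(2)[OF XD] by (simp add: D_def convergent_const)
    with a(1) show ?thesis
      using subspace_add[OF D_sub] by fastforce
  qed
  define f where "f y = lim (\<lambda>n. y \<bullet> X (r n))" for y
  have f: "(\<lambda>n. y \<bullet> X (r n)) \<longlonglongrightarrow> f y" for y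
    using D_UNIV[of y] by (simp add: D_def f_def convergent_LIMSEQ_iff)
  have "bounded_linear f"
  proof (rule bounded_linear_intro[where K = B])
    fix x y show "f (x + y) = f x + f y"
      by (rule LIMSEQ_unique[OF f]) (simp add: inner_add_left tendsto_add f)
  next
    fix c x show "f (c *\<^sub>R x) = c *\<^sub>R f x"
      by (rule LIMSEQ_unique[OF f]) (simp add: tendsto_mult_left f)
  next
    fix x
    have "norm (x \<bullet> X (r n)) \<le> norm x * B" for n
      by (rule order_trans[OF Cauchy_Schwarz_ineq2[folded real_norm_def] mult_left_mono]) (use B in auto)
    then show "norm (f x) \<le> norm x * B"
      by (intro LIMSEQ_le_const2[OF tendsto_norm[OF f]]) auto
  qed
  then obtain x where "\<And>y. f y = x \<bullet> y" using riesz_representation by blast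
  with f have "weakly_tendsto (X \<circ> r) x"
    unfolding weakly_tendsto_iff_inner by (simp add: inner_commute)
  with r show thesis by (rule that)
qed

lemma convex_sublevel:
  assumes "convex_fun F"
  shows "convex {x. F x \<le> ereal a}"
  unfolding convex_alt
proof (safe)
  fix x y and t :: real
  assume *: "F x \<le> ereal a" "F y \<le> ereal a" "0 \<le> t" "t \<le> 1"
  then have "F ((1 - t) *\<^sub>R x + t *\<^sub>R y) \<le> ereal (1 - t) * F x + ereal t * F y"
    using assms unfolding convex_fun_def by auto
  also have "\<dots> \<le> ereal (1 - t) * ereal a + ereal t * ereal a"
    using * by (intro add_mono ereal_mult_left_mono) auto
  finally show "F ((1 - t) *\<^sub>R x + t *\<^sub>R y) \<le> ereal a"
    by (simp add: algebra_simps)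
qed

text \<open>
  If the values dropped below \<open>F x\<close> infinitely often, a subsequence would stay in a sublevel set
  \<open>{x. F x \<le> a}\<close> with \<open>a < F x\<close>; being closed and convex, this set contains the weak limit \<open>x\<close>,
  a contradiction.
\<close>

proposition convex_closed_sublevels_weakly_lsc:
  fixes F :: "'a::{real_inner, complete_space} \<Rightarrow> ereal"
  assumes "convex_fun F" "\<And>a. closed {x. F x \<le> a}" "weakly_tendsto X x"
  shows "F x \<le> liminf (\<lambda>n. F (X n))"
  unfolding le_Liminf_iff
proof (intro allI impI, rule ccontr)
  fix y assume y: "y < F x" "\<not> (\<forall>\<^sub>F n in sequentially. y < F (X n))"
  obtain a where a: "y < ereal a" "ereal a < F x"
    using ereal_dense2[OF y(1)] by blast
  obtain r :: "nat \<Rightarrow> nat" where r: "strict_mono r" "\<And>n. \<not> y < F (X (r n))"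
    using not_eventually_sequentiallyD[OF y(2)] by blast
  have "F (X (r n)) \<le> ereal a" for n
    using r(2)[of n] a(1) by (meson not_le order_le_less_trans less_imp_le)
  then have "x \<in> {x. F x \<le> ereal a}"
    by (intro weak_limit_in_closed_convex[OF assms(2) convex_sublevel
          weakly_tendsto_subseq[OF assms(3) r(1)]] assms(1)) simp
  with a(2) show False by simp
qed

lemma compact_operator_bounded_subseq:
  assumes "compact_operator S" "bounded (range U)"
  obtains r y where "strict_mono (r :: nat \<Rightarrow> nat)" "(\<lambda>n. S (U (r n))) \<longlonglongrightarrow> y"
proof -
  have "compact (closure (S ` range U))"
    using assms by (simp add: compact_operator_def)
  moreover have "\<forall>n. S (U n) \<in> closure (S ` range U)"
    using closure_subset by fastforce
  ultimately obtain y r where "strict_mono r" "((\<lambda>n. S (U n)) \<circ> r) \<longlonglongrightarrow> y"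
    by (metis compact_def)
  then show thesis using that by (simp add: o_def)
qed

lemma tendsto_weakly_tendsto_unique:
  fixes X :: "nat \<Rightarrow> 'a::{real_inner, complete_space}"
  assumes "X \<longlonglongrightarrow> x" "weakly_tendsto X y"
  shows "x = y"
proof -
  have "w \<bullet> x = w \<bullet> y" for w
  proof (rule LIMSEQ_unique)
    show "(\<lambda>n. w \<bullet> X n) \<longlonglongrightarrow> w \<bullet> x" by (intro tendsto_inner tendsto_const assms(1))
    show "(\<lambda>n. w \<bullet> X n) \<longlonglongrightarrow> w \<bullet> y" using assms(2) by (simp add: weakly_tendsto_iff_inner)
  qed
  then show ?thesis by (metis vector_eq_ldot)
qed

section \<open>Adjoints as operators into a dual space\<close>

text \<open>
  By Baire, the closure of some \<open>A k\<close>, the set where all \<open>F n\<close> are bounded by \<open>k\<close>, has interior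
  points, and differences of its elements are dense in a ball around 0. Approximating a vector \<open>x\<close>
  of that ball successively by multiples of such differences, with halved errors, writes \<open>x\<close> as a
  series whose images under \<open>F n\<close> are dominated by a geometric series with the same ratio for all \<open>n\<close>.
  The closed graph, in place of continuity, identifies the sum of the images with \<open>F n x\<close>. Taking
  all \<open>F n\<close> equal gives the closed graph theorem, and for continuous \<open>F n\<close> this is
  the Banach-Steinhaus theorem.
\<close>

theorem uniform_boundedness_closed_operators:
  fixes F :: "nat \<Rightarrow> 'a::{real_normed_vector, complete_space} \<Rightarrow> 'b::banach"
  assumes linear: "\<And>n. linear (F n)"
    and closed_graph: "\<And>n X x l. X \<longlonglongrightarrow> x \<Longrightarrow> (\<lambda>i. F n (X i)) \<longlonglongrightarrow> l \<Longrightarrow> F n x = l"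
    and pointwise: "\<And>x. \<exists>B. \<forall>n. norm (F n x) \<le> B"
  obtains C where "\<And>n x. norm (F n x) \<le> C * norm x"
proof -
  interpret F: linear "F n" for n by (rule linear)
  define A where "A k = {x. \<forall>n. norm (F n x) \<le> k}" for k :: real
  have A_diff: "x - y \<in> A (2 * k)" if "x \<in> A k" "y \<in> A k" for x y k
  proof -
    have "norm (F n (x - y)) \<le> 2 * k" for n
      using that norm_triangle_ineq4[of "F n x" "F n y"] unfolding A_def F.diff
      by (smt (verit) mem_Collect_eq)
    then show ?thesis by (simp add: A_def)
  qed
  have A_scale: "c *\<^sub>R x \<in> A (c * k)" if "x \<in> A k" "0 \<le> c" for x c k
    using that by (auto simp: A_def F.scale mult_left_mono)
  have "\<exists>k::nat. interior (closure (A (real k))) \<noteq> {}"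
  proof (rule ccontr)
    assume *: "\<not> ?thesis"
    have "euclidean interior_of \<Union> (range (\<lambda>k::nat. closure (A (real k)))) = {}"
      by (rule Baire_category_alt) (use * in \<open>auto simp: completely_metrizable_space_euclidean\<close>)
    moreover have "\<Union> (range (\<lambda>k::nat. closure (A (real k)))) = UNIV"
    proof -
      have "x \<in> \<Union> (range (\<lambda>k::nat. closure (A (real k))))" for x
      proof -
        obtain B where B: "\<And>n. norm (F n x) \<le> B" using pointwise by blast
        obtain k :: nat where "B \<le> real k" using real_arch_simple by blast
        with B have "x \<in> A (real k)" by (force simp: A_def intro: order_trans)
        then show ?thesis using closure_subset by blast
      qed
      then show ?thesis by blast
    qed
    ultimately show False by simp
  qed
  then obtain k :: nat and a where "a \<in> interior (closure (A (real k)))" by blast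
  then obtain d where d: "0 < d" "ball a d \<subseteq> closure (A (real k))"
    by (auto simp: mem_interior)
  define K where "K = 2 * real k"
  have K0: "0 \<le> K" by (simp add: K_def)
  have approx1: "\<exists>y\<in>A K. norm (x - y) < e" if x: "norm x < d" and e: "0 < e" for x e
  proof -
    have "a + x \<in> closure (A (real k))" "a \<in> closure (A (real k))"
      using d x by (auto simp: dist_norm subset_iff)
    then obtain y y' where y: "y \<in> A (real k)" "dist y (a + x) < e / 2"
        "y' \<in> A (real k)" "dist y' a < e / 2"
      unfolding closure_approachable using e by (metis half_gt_zero)
    have eq: "x - (y - y') = (a + x - y) - (a - y')" by simp
    have "norm (a + x - y) < e / 2" "norm (a - y') < e / 2"
      using y by (metis dist_commute dist_norm)+
    then have "norm (x - (y - y')) < e"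
      unfolding eq using norm_triangle_ineq4[of "a + x - y" "a - y'"] by linarith
    then show ?thesis using A_diff[OF y(1,3)] unfolding K_def by blast
  qed
  have approx: "\<exists>y\<in>A (K * (1/2)^i). norm (x - y) < d * (1/2)^Suc i" if x: "norm x < d * (1/2)^i" for x i
  proof -
    \<comment> \<open>scaling by \<open>2^i\<close> reduces the approximation of small vectors to that of vectors in the ball of radius \<open>d\<close>\<close>
    have "norm (2^i *\<^sub>R x) < d" using x by (simp add: field_simps power_one_over)
    then obtain y where y: "y \<in> A K" "norm (2^i *\<^sub>R x - y) < d / 2"
      using approx1 d(1) half_gt_zero by metis
    have "x - (1/2)^i *\<^sub>R y = (1/2)^i *\<^sub>R (2^i *\<^sub>R x - y)"
      by (simp add: scaleR_diff_right power_one_over)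
    then have "norm (x - (1/2)^i *\<^sub>R y) = (1/2)^i * norm (2^i *\<^sub>R x - y)" by simp
    also have "\<dots> < (1/2)^i * (d / 2)" using y(2) by (intro mult_strict_left_mono) auto
    finally have "norm (x - (1/2)^i *\<^sub>R y) < d * (1/2)^Suc i" by (simp add: mult.commute)
    moreover have "(1/2)^i *\<^sub>R y \<in> A (K * (1/2)^i)"
      using A_scale[OF y(1), of "(1/2)^i"] by (simp add: mult.commute)
    ultimately show ?thesis by blast
  qed
  have bound: "norm (F n x) \<le> 2 * K" if x: "norm x < d" for n x
  proof -
    have "\<forall>i x. \<exists>y. norm x < d * (1/2)^i \<longrightarrow>
        y \<in> A (K * (1/2)^i) \<and> norm (x - y) < d * (1/2)^Suc i"
      using approx by blast
    then obtain Y where Y: "\<And>x i. norm x < d * (1/2)^i \<Longrightarrow>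
        Y i x \<in> A (K * (1/2)^i) \<and> norm (x - Y i x) < d * (1/2)^Suc i"
      by metis
    \<comment> \<open>\<open>R i\<close> is the error left after \<open>i\<close> approximations, \<open>y i\<close> the \<open>i\<close>-th correction\<close>
    define R where "R = rec_nat x (\<lambda>i r. r - Y i r)"
    have R0: "R 0 = x" and RS: "R (Suc i) = R i - Y i (R i)" for i
      by (simp_all add: R_def)
    have R: "norm (R i) < d * (1/2)^i" for i
      by (induction i) (use x Y in \<open>auto simp: R0 RS\<close>)
    define y where "y i = Y i (R i)" for i
    have y: "norm (F n (y i)) \<le> K * (1/2)^i" for i
      using Y[OF R[of i]] by (auto simp: A_def y_def)
    have partial: "(\<Sum>j<i. y j) = x - R i" for i
      by (induction i) (auto simp: R0 RS y_def)
    have "R \<longlonglongrightarrow> 0"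
    proof (rule Lim_null_comparison)
      show "\<forall>\<^sub>F i in sequentially. norm (R i) \<le> d * (1/2)^i"
        using R less_imp_le by (intro always_eventually) blast
      show "(\<lambda>i. d * (1/2)^i) \<longlonglongrightarrow> 0"
        using tendsto_mult_right_zero[OF LIMSEQ_realpow_zero[of "1/2"]] by simp
    qed
    then have to_x: "(\<lambda>i. \<Sum>j<i. y j) \<longlonglongrightarrow> x"
      unfolding partial using tendsto_diff[OF tendsto_const] by fastforce
    have geom: "(\<lambda>i. K * (1/2)^i) sums (2 * K)"
      using sums_mult[OF geometric_sums[of "1/2::real"], of K] by (simp add: mult.commute)
    have summ: "summable (\<lambda>i. norm (F n (y i)))"
      by (rule summable_comparison_test'[OF sums_summable[OF geom]]) (use y in auto)
    then have "(\<lambda>i. F n (\<Sum>j<i. y j)) \<longlonglongrightarrow> (\<Sum>i. F n (y i))"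
      unfolding F.sum by (rule summable_LIMSEQ[OF summable_norm_cancel])
    with to_x have "F n x = (\<Sum>i. F n (y i))" by (rule closed_graph)
    also have "norm \<dots> \<le> (\<Sum>i. norm (F n (y i)))" by (rule summable_norm[OF summ])
    also have "\<dots> \<le> 2 * K"
      using suminf_le[OF y summ sums_summable[OF geom]] sums_unique[OF geom] by simp
    finally show ?thesis .
  qed
  show thesis
  proof (rule that)
    fix n x
    show "norm (F n x) \<le> (4 * K / d) * norm x"
    proof (cases "x = 0")
      case True
      then show ?thesis by (simp add: F.zero)
    next
      case False
      \<comment> \<open>half the critical scale, because \<open>bound\<close> needs the strict inequality \<open>norm (c *\<^sub>R x) < d\<close>\<close>
      define c where "c = d / (2 * norm x)"
      have c: "0 < c" "norm (c *\<^sub>R x) < d" using False d(1) by (auto simp: c_def)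
      have "c * norm (F n x) = norm (F n (c *\<^sub>R x))" using c by (simp add: F.scale)
      also have "\<dots> \<le> 2 * K" by (rule bound[OF c(2)])
      finally have "norm (F n x) \<le> 2 * K / c" using c(1) by (simp add: field_simps)
      then show ?thesis using False d(1) by (simp add: c_def field_simps)
    qed
  qed
qed

lemma dual_embedding_inner:
  fixes j :: "'u::{real_inner, complete_space} \<Rightarrow> 'v::real_normed_vector"
  assumes "bounded_linear j"
  shows "dual_embedding j \<phi> \<bullet> u = blinfun_apply \<phi> (j u)"
proof -
  have "bounded_linear (\<lambda>u. blinfun_apply \<phi> (j u))"
    by (rule bounded_linear_compose[OF blinfun.bounded_linear_right assms])
  then obtain w where w: "\<And>u. blinfun_apply \<phi> (j u) = w \<bullet> u"
    using riesz_representation by blast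
  have "dual_embedding j \<phi> = w"
    unfolding dual_embedding_def
    by (rule the_equality) (auto simp: w intro: vector_eq_rdot[THEN iffD1])
  then show ?thesis by (simp add: w)
qed

lemma dual_embedding_eqI:
  fixes j :: "'u::{real_inner, complete_space} \<Rightarrow> 'v::real_normed_vector"
  assumes "bounded_linear j" "\<And>u. w \<bullet> u = blinfun_apply \<phi> (j u)"
  shows "dual_embedding j \<phi> = w"
proof (rule vector_eq_rdot[THEN iffD1], rule allI)
  show "dual_embedding j \<phi> \<bullet> u = w \<bullet> u" for u
    by (simp add: assms(2) dual_embedding_inner[OF assms(1)])
qed

lemma dual_norm_dual_embedding:
  "inj (dual_embedding j) \<Longrightarrow> dual_norm j (dual_embedding j \<phi>) = norm \<phi>"
  by (simp add: dual_norm_def)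

text \<open>
  Lifted to the dual of \<open>'v\<close>, the adjoints become operators \<open>F n\<close> and \<open>F0\<close> between Banach spaces
  that are characterized by testing against \<open>j u\<close>. Convergence in the dual of \<open>'v\<close> is
  preserved by these tests, so the graphs are closed, and uniform boundedness upgrades pointwise
  convergence to convergence along \<open>W\<close>.
\<close>

proposition tendsto_in_dual_adjoint:
  fixes j :: "'u::{real_inner, complete_space} \<Rightarrow> 'v::real_normed_vector"
    and T :: "nat \<Rightarrow> 'u \<Rightarrow> 'y::{real_inner, complete_space}"
  assumes j: "bounded_linear j" "inj (dual_embedding j)"
    and T: "\<And>n. bounded_linear (T n)" and L: "bounded_linear L"
    and T_dual: "\<And>n y. adjoint (T n) y \<in> dual_space j" and L_dual: "\<And>y. adjoint L y \<in> dual_space j"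
    and pointwise: "\<And>y. (\<lambda>n. dual_norm j (adjoint (\<lambda>h. T n h - L h) y)) \<longlonglongrightarrow> 0"
    and w: "W \<longlonglongrightarrow> w"
  shows "tendsto_in_dual j (\<lambda>n. adjoint (T n) (W n)) (adjoint L w)"
proof -
  define F where "F n y = inv (dual_embedding j) (adjoint (T n) y)" for n y
  define F0 where "F0 y = inv (dual_embedding j) (adjoint L y)" for y
  have F: "dual_embedding j (F n y) = adjoint (T n) y" for n y
    using T_dual unfolding F_def dual_space_def by (rule f_inv_into_f)
  have F0: "dual_embedding j (F0 y) = adjoint L y" for y
    using L_dual unfolding F0_def dual_space_def by (rule f_inv_into_f)
  have F_apply: "blinfun_apply (F n y) (j u) = y \<bullet> T n u" for n y u
    using dual_embedding_inner[OF j(1), of "F n y" u] adjoint_characterization[OF T, of n y u]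
    by (simp add: F)
  have F0_apply: "blinfun_apply (F0 y) (j u) = y \<bullet> L u" for y u
    using dual_embedding_inner[OF j(1), of "F0 y" u] adjoint_characterization[OF L, of y u]
    by (simp add: F0)
  \<comment> \<open>a functional is determined by its values on the range of \<open>j\<close>, since \<open>dual_embedding j\<close> is injective\<close>
  have eqI: "\<phi> = \<psi>" if "\<And>u. blinfun_apply \<phi> (j u) = blinfun_apply \<psi> (j u)" for \<phi> \<psi> :: "'v \<Rightarrow>\<^sub>L real"
    using that j by (metis dual_embedding_eqI dual_embedding_inner injD)
  have dist_F: "norm (F n y - F0 y) = dual_norm j (adjoint (\<lambda>h. T n h - L h) y)" for n y
  proof -
    have "dual_embedding j (F n y - F0 y) = adjoint (\<lambda>h. T n h - L h) y"
      by (rule dual_embedding_eqI[OF j(1)])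
        (simp add: adjoint_characterization[OF bounded_linear_sub[OF T L]]
          F_apply F0_apply blinfun.diff_left inner_diff_right)
    then show ?thesis using dual_norm_dual_embedding[OF j(2)] by metis
  qed
  have F_lim: "(\<lambda>n. F n y) \<longlonglongrightarrow> F0 y" for y
    by (rule LIM_zero_cancel, rule tendsto_norm_zero_cancel) (simp add: dist_F pointwise)
  obtain C where C: "\<And>n y. norm (F n y) \<le> C * norm y"
  proof (rule uniform_boundedness_closed_operators[of F])
    fix n show "linear (F n)"
      by (rule linearI; rule eqI)
        (simp_all add: F_apply blinfun.add_left blinfun.scaleR_left inner_add_left)
  next
    fix n Y y l
    assume Y: "Y \<longlonglongrightarrow> y" and l: "(\<lambda>i. F n (Y i)) \<longlonglongrightarrow> l"
    show "F n y = l"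
    proof (rule eqI)
      fix u
      have "(\<lambda>i. blinfun_apply (F n (Y i)) (j u)) \<longlonglongrightarrow> blinfun_apply l (j u)"
        by (intro blinfun.tendsto l tendsto_const)
      moreover have "(\<lambda>i. blinfun_apply (F n (Y i)) (j u)) \<longlonglongrightarrow> blinfun_apply (F n y) (j u)"
        unfolding F_apply by (intro tendsto_inner Y tendsto_const)
      ultimately show "blinfun_apply (F n y) (j u) = blinfun_apply l (j u)"
        by (rule LIMSEQ_unique[rotated])
    qed
  next
    fix y
    show "\<exists>B. \<forall>n. norm (F n y) \<le> B"
      using convergent_imp_Bseq[OF convergentI[OF F_lim[of y]]] by (auto simp: Bseq_def)
  qed blast
  have "(\<lambda>n. F n (W n - w) + F n w) \<longlonglongrightarrow> 0 + F0 w"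
  proof (intro tendsto_add F_lim)
    show "(\<lambda>n. F n (W n - w)) \<longlonglongrightarrow> 0"
    proof (rule Lim_null_comparison)
      show "\<forall>\<^sub>F n in sequentially. norm (F n (W n - w)) \<le> C * norm (W n - w)"
        using C by simp
      show "(\<lambda>n. C * norm (W n - w)) \<longlonglongrightarrow> 0"
        using tendsto_mult_right_zero[OF tendsto_norm_zero[OF LIM_zero[OF w]]] by blast
    qed
  qed
  moreover have "F n (W n - w) + F n w = F n (W n)" for n
    by (rule eqI) (simp add: F_apply blinfun.add_left inner_diff_left)
  ultimately have "(\<lambda>n. norm (F n (W n) - F0 w)) \<longlonglongrightarrow> 0"
    using tendsto_norm_zero[OF LIM_zero] by fastforce
  moreover have "dual_norm j (adjoint (T n) (W n) - adjoint L w) = norm (F n (W n) - F0 w)" for n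
  proof -
    have "dual_embedding j (F n (W n) - F0 w) = adjoint (T n) (W n) - adjoint L w"
      by (rule dual_embedding_eqI[OF j(1)])
        (simp add: inner_diff_left adjoint_characterization T L F_apply F0_apply blinfun.diff_left)
    then show ?thesis using dual_norm_dual_embedding[OF j(2)] by metis
  qed
  ultimately show ?thesis
    unfolding tendsto_in_dual_def using T_dual L_dual by auto
qed

section \<open>Convex integral functionals on the space of square-integrable functions\<close>

lemma lower_semicontinuous_open_superlevel:
  assumes "lower_semicontinuous g"
  shows "open {x. y < g x}"
proof (subst open_subopen, safe)
  fix x assume y: "y < g x"
  then have "eventually (\<lambda>z. y < g z) (at x)"
    using assms unfolding lower_semicontinuous_def le_Liminf_iff by blast
  with y have "eventually (\<lambda>z. y < g z) (nhds x)"
    unfolding eventually_at_filter by (auto elim: eventually_mono)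
  then show "\<exists>T. open T \<and> x \<in> T \<and> T \<subseteq> {z. y < g z}"
    unfolding eventually_nhds by blast
qed

lemma lower_semicontinuous_borel_measurable:
  "lower_semicontinuous g \<Longrightarrow> g \<in> borel_measurable borel"
  by (rule borel_measurableI_greater) (simp add: lower_semicontinuous_open_superlevel)

text \<open>
  The open sets where \<open>g\<close> exceeds \<open>- n\<close> cover the compact effective domain, so finitely many do.
\<close>

lemma lower_semicontinuous_bounded_below:
  assumes "lower_semicontinuous g" "\<And>x. g x \<noteq> -\<infinity>" "compact K" "effective_domain g = K"
  obtains C where "0 \<le> C" "\<And>x. ereal (- C) \<le> g x"
proof -
  have "K \<subseteq> (\<Union>n::nat. {x. ereal (- real n) < g x})"
  proof
    fix x
    obtain n :: nat where "ereal (- real n) < g x"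
    proof (cases "g x")
      case (real r)
      obtain n :: nat where "- r < real n" using reals_Archimedean2 by blast
      then show thesis using real by (intro that[of n]) auto
    qed (use assms(2) that[of 0] in auto)
    then show "x \<in> (\<Union>n::nat. {x. ereal (- real n) < g x})" by blast
  qed
  then obtain N where N: "finite N" "K \<subseteq> (\<Union>n\<in>N. {x. ereal (- real n) < g x})"
    by (rule compactE_image[OF assms(3) lower_semicontinuous_open_superlevel[OF assms(1)]])
  show thesis
  proof (rule that)
    fix x
    show "ereal (- real (\<Sum>N)) \<le> g x"
    proof (cases "x \<in> K")
      case True
      then obtain n where n: "n \<in> N" "ereal (- real n) < g x" using N by blast
      then have "n \<le> \<Sum>N" using member_le_sum[of n N "\<lambda>i. i"] N(1) by simp
      then have "ereal (- real (\<Sum>N)) \<le> ereal (- real n)" by (simp del: of_nat_sum)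
      also have "\<dots> \<le> g x" using n by simp
      finally show ?thesis .
    next
      case False
      then show ?thesis using assms(4) by (auto simp: effective_domain_def not_less)
    qed
  qed (rule of_nat_0_le_iff)
qed

text \<open>
  Adding the constant \<open>C\<close> to an integrand bounded below by \<open>- C\<close> makes it nonnegative, so that its
  integral is a single \<open>nn_integral\<close>, for which Fatou's lemma and monotonicity are available for
  infinite values too.
\<close>

lemma ereal_integral_shift:
  assumes "finite_measure N" and f[measurable]: "f \<in> borel_measurable N"
    and C: "0 \<le> C" "\<And>x. ereal (- C) \<le> f x"
  shows "ereal_integral N f =
    enn2ereal (\<integral>\<^sup>+ x. e2ennreal (f x + ereal C) \<partial>N) - ereal (C * measure N (space N))"
proof -
  interpret finite_measure N by fact
  let ?A = "\<integral>\<^sup>+ x. e2ennreal (f x) \<partial>N" and ?B = "\<integral>\<^sup>+ x. e2ennreal (- f x) \<partial>N"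
    and ?K = "\<integral>\<^sup>+ x. e2ennreal (f x + ereal C) \<partial>N"
  have pointwise: "e2ennreal (f x) + ennreal C = e2ennreal (f x + ereal C) + e2ennreal (- f x)" for x
  proof (cases "f x")
    case (real r)
    then have "- C \<le> r" using C(2)[of x] by simp
    then show ?thesis
      using real C(1) by (cases "0 \<le> r") (auto simp: ennreal_neg simp flip: ennreal_plus)
  qed (use C(2)[of x] in \<open>auto simp: e2ennreal_neg\<close>)
  have C_int: "(\<integral>\<^sup>+ x. ennreal C \<partial>N) = ennreal (C * measure N (space N))"
    using C(1) by (simp add: emeasure_eq_measure ennreal_mult)
  have "?A + (\<integral>\<^sup>+ x. ennreal C \<partial>N) = (\<integral>\<^sup>+ x. e2ennreal (f x) + ennreal C \<partial>N)"
    by (rule nn_integral_add[symmetric]) auto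
  also have "\<dots> = ?K + ?B"
    unfolding pointwise by (rule nn_integral_add) auto
  finally have "?A + ennreal (C * measure N (space N)) = ?K + ?B"
    unfolding C_int .
  \<comment> \<open>finiteness of \<open>?B\<close> allows it to be subtracted from \<open>?A + C * measure N (space N) = ?K + ?B\<close>\<close>
  moreover have "?B \<le> ennreal (C * measure N (space N))"
    unfolding C_int[symmetric]
  proof (rule nn_integral_mono)
    fix x
    have "- f x \<le> ereal C" using C(2)[of x] by (cases "f x") auto
    then show "e2ennreal (- f x) \<le> ennreal C" using e2ennreal_mono by fastforce
  qed
  moreover have "0 \<le> C * measure N (space N)" using C(1) by simp
  ultimately show ?thesis
    unfolding ereal_integral_def
    by (cases ?A; cases ?B; cases ?K) (auto simp: top_unique simp flip: ennreal_plus)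
qed

text \<open>
  The shift \<open>C\<close> is part of the data in order that \<open>g + C\<close> is nonnegative and its integral a plain
  \<open>nn_integral\<close>.
\<close>

locale convex_integrand =
  fixes \<Omega> :: "(real ^ 'n) set"
    and rep :: "'u::real_inner \<Rightarrow> real ^ 'n \<Rightarrow> real ^ 'm"
    and g :: "real ^ 'm \<Rightarrow> ereal" and C :: real
  assumes \<Omega>: "\<Omega> \<in> lmeasurable"
    and L2: "is_L2_space \<Omega> rep"
    and convex: "convex_fun g"
    and lsc: "lower_semicontinuous g"
    and C: "0 \<le> C" "\<And>x. ereal (- C) \<le> g x"
begin

abbreviation \<mu> :: "(real ^ 'n) measure" where "\<mu> \<equiv> lebesgue_on \<Omega>"

definition shifted :: "real ^ 'm \<Rightarrow> ennreal" where
  "shifted x = e2ennreal (g x + ereal C)"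

definition shifted_integral :: "'u \<Rightarrow> ennreal" where
  "shifted_integral u = (\<integral>\<^sup>+ x. shifted (rep u x) \<partial>\<mu>)"

lemma finite_measure_domain: "finite_measure \<mu>"
  by (rule finite_measure_lebesgue_on[OF \<Omega>])

lemma rep_measurable[measurable]: "rep u \<in> borel_measurable \<mu>"
  using L2 by (auto simp: is_L2_space_def L2_def)

lemma g_measurable[measurable]: "g \<in> borel_measurable borel"
  by (rule lower_semicontinuous_borel_measurable[OF lsc])

lemma shifted_measurable[measurable]: "shifted \<in> borel_measurable borel"
  unfolding shifted_def by measurable

lemma rep_add: "AE x in \<mu>. rep (u + v) x = rep u x + rep v x"
  and rep_scale: "AE x in \<mu>. rep (c *\<^sub>R u) x = c *\<^sub>R rep u x"
  and inner_rep: "u \<bullet> v = (\<integral>x. rep u x \<bullet> rep v x \<partial>\<mu>)"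
  using L2 by (auto simp: is_L2_space_def)

lemma norm_rep_integrable: "integrable \<mu> (\<lambda>x. (norm (rep u x))\<^sup>2)"
  using L2 by (auto simp: is_L2_space_def L2_def)

lemma norm_rep: "(norm u)\<^sup>2 = (\<integral>x. (norm (rep u x))\<^sup>2 \<partial>\<mu>)"
  by (simp add: power2_norm_eq_inner inner_rep)

lemma shifted_finite_iff: "shifted x < top \<longleftrightarrow> x \<in> effective_domain g"
  using C(2)[of x] by (cases "g x") (auto simp: shifted_def effective_domain_def)

lemma integral_functional_eq:
  "integral_functional \<Omega> rep g u = enn2ereal (shifted_integral u) - ereal (C * measure \<mu> (space \<mu>))"
  unfolding integral_functional_def shifted_integral_def shifted_def
  by (rule ereal_integral_shift[OF finite_measure_domain _ C]) measurable

lemma shifted_integral_finite_iff: "shifted_integral u < top \<longleftrightarrow> integral_functional \<Omega> rep g u < \<infinity>"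
  unfolding integral_functional_eq by (cases "shifted_integral u") auto

lemma integral_functional_gt: "-\<infinity> < integral_functional \<Omega> rep g u"
  unfolding integral_functional_eq by (cases "shifted_integral u") auto

lemma shifted_convex:
  assumes t: "t \<in> {0..1}"
  shows "shifted ((1 - t) *\<^sub>R x + t *\<^sub>R y) \<le> ennreal (1 - t) * shifted x + ennreal t * shifted y"
proof (cases "t = 0 \<or> t = 1")
  case True
  then show ?thesis by auto
next
  case False
  then have t: "0 < t" "t < 1" using assms by auto
  show ?thesis
  proof (cases "g x = \<infinity> \<or> g y = \<infinity>")
    case True
    then show ?thesis using t by (auto simp: shifted_def ennreal_mult_top)
  next
    case False
    then obtain a b where ab: "g x = ereal a" "g y = ereal b" "-C \<le> a" "-C \<le> b"
      using C(2)[of x] C(2)[of y] by (cases "g x"; cases "g y") auto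
    have "g ((1 - t) *\<^sub>R x + t *\<^sub>R y) \<le> ereal (1 - t) * g x + ereal t * g y"
      using convex assms unfolding convex_fun_def by blast
    then have "g ((1 - t) *\<^sub>R x + t *\<^sub>R y) + ereal C \<le> ereal ((1 - t) * a + t * b) + ereal C"
      unfolding ab by (intro add_right_mono) simp
    also have "\<dots> = ereal ((1 - t) * (a + C) + t * (b + C))" by (simp add: algebra_simps)
    finally have "shifted ((1 - t) *\<^sub>R x + t *\<^sub>R y) \<le> ennreal ((1 - t) * (a + C) + t * (b + C))"
      unfolding shifted_def using e2ennreal_mono by fastforce
    also have "\<dots> = ennreal (1 - t) * shifted x + ennreal t * shifted y"
      using t ab by (simp add: shifted_def ennreal_plus ennreal_mult)
    finally show ?thesis .
  qed
qed

lemma convex_integral_functional: "convex_fun (integral_functional \<Omega> rep g)"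
  unfolding convex_fun_def
proof (intro allI ballI)
  fix u v :: 'u and t :: real assume t: "t \<in> {0..1}"
  let ?w = "(1 - t) *\<^sub>R u + t *\<^sub>R v"
  have "AE x in \<mu>. rep ?w x = (1 - t) *\<^sub>R rep u x + t *\<^sub>R rep v x"
    using rep_add[of "(1 - t) *\<^sub>R u" "t *\<^sub>R v"] rep_scale[of "1 - t" u] rep_scale[of t v]
    by eventually_elim simp
  then have "AE x in \<mu>. shifted (rep ?w x) \<le> ennreal (1 - t) * shifted (rep u x) + ennreal t * shifted (rep v x)"
    by eventually_elim (simp add: shifted_convex[OF t])
  then have "shifted_integral ?w \<le> (\<integral>\<^sup>+ x. ennreal (1 - t) * shifted (rep u x) + ennreal t * shifted (rep v x) \<partial>\<mu>)"
    unfolding shifted_integral_def by (rule nn_integral_mono_AE)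
  also have "\<dots> = ennreal (1 - t) * shifted_integral u + ennreal t * shifted_integral v"
    unfolding shifted_integral_def by (subst nn_integral_add) (auto simp: nn_integral_cmult)
  finally have le: "shifted_integral ?w \<le> ennreal (1 - t) * shifted_integral u + ennreal t * shifted_integral v" .
  consider "t = 0" | "t = 1" | "0 < t" "t < 1" using t by fastforce
  then show "integral_functional \<Omega> rep g ?w
      \<le> ereal (1 - t) * integral_functional \<Omega> rep g u + ereal t * integral_functional \<Omega> rep g v"
  proof cases
    case 3
    define c where "c = C * measure \<mu> (space \<mu>)"
    show ?thesis
    proof (cases "shifted_integral u = top \<or> shifted_integral v = top")
      case True
      then show ?thesis
        unfolding integral_functional_eq using 3 by (cases "shifted_integral u"; cases "shifted_integral v") auto
    next
      case False
      then obtain a b where ab: "0 \<le> a" "shifted_integral u = ennreal a" "0 \<le> b" "shifted_integral v = ennreal b"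
        by (cases "shifted_integral u"; cases "shifted_integral v") auto
      have "shifted_integral ?w \<le> ennreal ((1 - t) * a + t * b)"
        using le ab 3 by (simp add: ennreal_mult ennreal_plus)
      then have "enn2ereal (shifted_integral ?w) \<le> ereal ((1 - t) * a + t * b)"
        using ab 3 enn2ereal_ennreal[of "(1 - t) * a + t * b"]
        by (simp add: less_eq_ennreal.rep_eq del: enn2ereal_ennreal)
      then have "enn2ereal (shifted_integral ?w) - ereal c \<le> ereal ((1 - t) * a + t * b) - ereal c"
        by (intro ereal_minus_mono) auto
      also have "\<dots> = ereal (1 - t) * (enn2ereal (shifted_integral u) - ereal c) + ereal t * (enn2ereal (shifted_integral v) - ereal c)"
        using ab by (simp add: algebra_simps)
      finally show ?thesis unfolding integral_functional_eq c_def .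
    qed
  qed (simp_all add: zero_ereal_def[symmetric])
qed

lemma shifted_le_liminf:
  assumes "X \<longlonglongrightarrow> x"
  shows "shifted x \<le> liminf (\<lambda>n. shifted (X n))"
  unfolding le_Liminf_iff
proof (intro allI impI)
  fix y assume y: "y < shifted x"
  \<comment> \<open>strict superlevel sets of the shifted integrand are superlevel sets of \<open>g\<close>\<close>
  have shift: "y < shifted z \<longleftrightarrow> enn2ereal y - ereal C < g z" for z
  proof -
    have "0 \<le> g z + ereal C" using C(2)[of z] by (cases "g z") auto
    then have "enn2ereal (shifted z) = g z + ereal C" by (simp add: shifted_def enn2ereal_e2ennreal)
    then show ?thesis
      unfolding less_ennreal.rep_eq by (cases "g z"; cases "enn2ereal y") auto
  qed
  have "eventually (\<lambda>n. X n \<in> {z. enn2ereal y - ereal C < g z}) sequentially"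
    using assms y lower_semicontinuous_open_superlevel[OF lsc]
    by (intro topological_tendstoD) (auto simp: shift)
  then show "eventually (\<lambda>n. y < shifted (X n)) sequentially"
    by (simp add: shift)
qed

text \<open>
  Norm convergence in \<open>'u\<close> says that the squares \<open>(norm (rep (U n - u) x))\<^sup>2\<close> tend to 0 in the mean.
\<close>

lemma rep_subseq_AE_tendsto:
  assumes "U \<longlonglongrightarrow> u"
  obtains r where "strict_mono r" "AE x in \<mu>. (\<lambda>n. rep (U (r n)) x) \<longlonglongrightarrow> rep u x"
proof -
  have "(\<lambda>n. (norm (U n - u))\<^sup>2) \<longlonglongrightarrow> 0"
    using tendsto_power[OF tendsto_norm_zero[OF LIM_zero[OF assms]], of 2] by simp
  then have "(\<lambda>n. \<integral>x. norm ((norm (rep (U n - u) x))\<^sup>2) \<partial>\<mu>) \<longlonglongrightarrow> 0"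
    by (simp add: norm_rep)
  then obtain r where r: "strict_mono r"
      and lim: "AE x in \<mu>. (\<lambda>n. (norm (rep (U (r n) - u) x))\<^sup>2) \<longlonglongrightarrow> 0"
    using tendsto_L1_AE_subseq[of \<mu> "\<lambda>n x. (norm (rep (U n - u) x))\<^sup>2"] norm_rep_integrable by blast
  have "AE x in \<mu>. \<forall>n. rep (U n - u + u) x = rep (U n - u) x + rep u x"
    unfolding AE_all_countable using rep_add by blast
  with lim have "AE x in \<mu>. (\<lambda>n. rep (U (r n)) x) \<longlonglongrightarrow> rep u x"
  proof eventually_elim
    case (elim x)
    have "(\<lambda>n. norm (rep (U (r n) - u) x)) \<longlonglongrightarrow> 0"
      using tendsto_real_sqrt[OF elim(1)] by simp
    then have "(\<lambda>n. rep (U (r n) - u) x) \<longlonglongrightarrow> 0" by (rule tendsto_norm_zero_cancel)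
    then show ?case
      using elim(2) tendsto_add[OF _ tendsto_const, of "\<lambda>n. rep (U (r n) - u) x" 0 sequentially "rep u x"]
      by simp
  qed
  with r show thesis by (rule that)
qed

text \<open>
  Fatou's lemma along an almost everywhere convergent subsequence, at each point of which the lower
  semicontinuity of \<open>g\<close> applies.
\<close>

lemma closed_sublevel_integral_functional: "closed {u. integral_functional \<Omega> rep g u \<le> a}"
  unfolding closed_sequential_limits
proof (intro allI impI, elim conjE)
  fix U u
  assume U: "\<forall>n. U n \<in> {u. integral_functional \<Omega> rep g u \<le> a}" and lim: "U \<longlonglongrightarrow> u"
  define b where "b = a + ereal (C * measure \<mu> (space \<mu>))"
  have le_iff: "integral_functional \<Omega> rep g v \<le> a \<longleftrightarrow> enn2ereal (shifted_integral v) \<le> b" for v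
    unfolding integral_functional_eq b_def by (simp add: ereal_minus_le)
  have b: "enn2ereal (shifted_integral (U n)) \<le> b" for n
    using U le_iff by simp
  then have "0 \<le> b" using enn2ereal_nonneg order_trans by blast
  obtain r where r: "AE x in \<mu>. (\<lambda>n. rep (U (r n)) x) \<longlonglongrightarrow> rep u x"
    using rep_subseq_AE_tendsto[OF lim] by blast
  have "shifted_integral u \<le> (\<integral>\<^sup>+ x. liminf (\<lambda>n. shifted (rep (U (r n)) x)) \<partial>\<mu>)"
    unfolding shifted_integral_def
    by (rule nn_integral_mono_AE) (use r in eventually_elim, rule shifted_le_liminf)
  also have "\<dots> \<le> liminf (\<lambda>n. shifted_integral (U (r n)))"
    unfolding shifted_integral_def by (rule nn_integral_liminf) measurable
  also have "\<dots> \<le> e2ennreal b"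
  proof -
    have "shifted_integral (U n) \<le> e2ennreal b" for n
      using e2ennreal_mono[OF b[of n]] by simp
    then show ?thesis by (intro Liminf_le) auto
  qed
  finally have "enn2ereal (shifted_integral u) \<le> b"
    using \<open>0 \<le> b\<close> by (simp add: less_eq_ennreal.rep_eq enn2ereal_e2ennreal)
  then show "u \<in> {u. integral_functional \<Omega> rep g u \<le> a}"
    by (simp add: le_iff)
qed

lemma integral_functional_finite_at_const:
  assumes "g m < \<infinity>"
  obtains u where "integral_functional \<Omega> rep g u < \<infinity>"
proof -
  interpret finite_measure \<mu> by (rule finite_measure_domain)
  have "(\<lambda>_. m) \<in> L2 \<Omega>" by (simp add: L2_def)
  moreover have "\<forall>f\<in>L2 \<Omega>. \<exists>u. AE x in \<mu>. rep u x = f x"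
    using L2 by (simp add: is_L2_space_def)
  ultimately obtain u where "AE x in \<mu>. rep u x = m"
    by (blast dest: bspec)
  then have "AE x in \<mu>. shifted (rep u x) = shifted m"
    by eventually_elim simp
  then have "shifted_integral u = (\<integral>\<^sup>+ x. shifted m \<partial>\<mu>)"
    unfolding shifted_integral_def by (rule nn_integral_cong_AE)
  moreover have "shifted m < top" using assms by (simp add: shifted_finite_iff effective_domain_def)
  ultimately have "shifted_integral u < top"
    by (simp add: emeasure_eq_measure ennreal_mult_less_top)
  then show thesis using that shifted_integral_finite_iff by blast
qed

lemma bounded_effective_domain_integral_functional:
  assumes "bounded (effective_domain g)"
  obtains R where "\<And>u. integral_functional \<Omega> rep g u < \<infinity> \<Longrightarrow> norm u \<le> R"
proof -
  interpret finite_measure \<mu> by (rule finite_measure_domain)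
  obtain B where B: "\<And>x. x \<in> effective_domain g \<Longrightarrow> norm x \<le> B"
    using assms by (auto simp: bounded_iff)
  show thesis
  proof (rule that)
    fix u assume "integral_functional \<Omega> rep g u < \<infinity>"
    then have "shifted_integral u \<noteq> top" using shifted_integral_finite_iff[of u] by auto
    then have "AE x in \<mu>. shifted (rep u x) \<noteq> top"
      unfolding shifted_integral_def by (intro nn_integral_PInf_AE[unfolded infinity_ennreal_def]) auto
    then have "AE x in \<mu>. (norm (rep u x))\<^sup>2 \<le> B\<^sup>2"
    proof eventually_elim
      case (elim x)
      then have "norm (rep u x) \<le> B" using B shifted_finite_iff top.not_eq_extremum by blast
      then show ?case by (simp add: power_mono)
    qed
    then have "(norm u)\<^sup>2 \<le> (\<integral>x. B\<^sup>2 \<partial>\<mu>)"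
      unfolding norm_rep by (intro integral_mono_AE norm_rep_integrable) auto
    then show "norm u \<le> sqrt (\<integral>x. B\<^sup>2 \<partial>\<mu>)" by (rule real_le_rsqrt)
  qed
qed

end

section \<open>Optimality conditions and stability of minimizers\<close>

text \<open>
  The tracking term converges along \<open>U\<close> and also at each fixed competitor \<open>v\<close>, so the limit inferior
  can be taken on both sides of the minimality inequality.
\<close>

lemma minimizer_of_limit_problem:
  fixes S :: "'u \<Rightarrow> 'y::real_normed_vector"
  assumes min: "\<And>n. is_minimizer (tracking_energy S G (Z n)) (U n)"
    and Z: "Z \<longlonglongrightarrow> z" and SU: "(\<lambda>n. S (U n)) \<longlonglongrightarrow> S u"
    and G: "G u \<le> liminf (\<lambda>n. G (U n))"
  shows "is_minimizer (tracking_energy S G z) u"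
proof -
  have "tracking_energy S G z u \<le> tracking_energy S G z v" for v
  proof -
    have "tracking_energy S G z u \<le> ereal (1 / 2 * (norm (S u - z))\<^sup>2) + liminf (\<lambda>n. G (U n))"
      unfolding tracking_energy_def using G by (rule add_left_mono)
    also have "\<dots> = liminf (\<lambda>n. ereal (1 / 2 * (norm (S (U n) - Z n))\<^sup>2) + G (U n))"
      by (intro ereal_liminf_lim_add[symmetric] tendsto_intros Z SU) auto
    also have "\<dots> \<le> liminf (\<lambda>n. tracking_energy S G (Z n) v)"
      using min by (intro Liminf_mono always_eventually)
        (auto simp: tracking_energy_def is_arg_min_def not_less)
    also have "\<dots> = liminf (\<lambda>n. ereal (1 / 2 * (norm (S v - Z n))\<^sup>2) + G v)"
      by (simp add: tracking_energy_def)
    also have "\<dots> = tracking_energy S G z v"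
      unfolding tracking_energy_def
    proof (rule lim_imp_Liminf[OF sequentially_bot tendsto_add_ereal_general2[OF _ _ tendsto_const]])
      show "(\<lambda>n. ereal (1 / 2 * (norm (S v - Z n))\<^sup>2)) \<longlonglongrightarrow> ereal (1 / 2 * (norm (S v - z))\<^sup>2)"
        by (intro tendsto_intros Z)
    qed simp
    finally show ?thesis .
  qed
  then show ?thesis by (auto simp: is_arg_min_def not_less)
qed

text \<open>
  Along the segment from \<open>u\<close> to \<open>v\<close>, convexity bounds \<open>G\<close> by its linear interpolation, so
  minimality bounds the difference quotients of the smooth tracking term \<open>\<phi>\<close> from below by
  \<open>G u - G v\<close>. Letting them tend to the derivative of \<open>\<phi>\<close> at 0 gives the claim.
\<close>

lemma tracking_minimizer_variational_inequality:
  fixes S :: "'u::real_normed_vector \<Rightarrow> 'y::real_inner"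
  assumes min: "is_minimizer (tracking_energy S G z) u"
    and G: "convex_fun G" "\<And>v. G v \<noteq> -\<infinity>" "G u < \<infinity>"
    and S: "(S has_derivative S') (at u)"
  shows "G u + ereal ((z - S u) \<bullet> S' (v - u)) \<le> G v"
proof (cases "G v = \<infinity>")
  case False
  then obtain a b where ab: "G u = ereal a" "G v = ereal b"
    using G(2)[of u] G(2)[of v] G(3) by (cases "G u"; cases "G v") auto
  define \<phi> where "\<phi> t = 1 / 2 * (norm (S (u + t *\<^sub>R (v - u)) - z))\<^sup>2" for t :: real
  have lower: "a - b \<le> (\<phi> t - \<phi> 0) / t" if t: "0 < t" "t < 1" for t
  proof -
    let ?w = "(1 - t) *\<^sub>R u + t *\<^sub>R v"
    have w: "u + t *\<^sub>R (v - u) = ?w" by (simp add: algebra_simps)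
    have "G ?w \<le> ereal (1 - t) * G u + ereal t * G v"
      using G(1) t unfolding convex_fun_def by auto
    then have "tracking_energy S G z ?w \<le> ereal (\<phi> t + ((1 - t) * a + t * b))"
      unfolding tracking_energy_def \<phi>_def w ab by (cases "G ?w") auto
    moreover have "tracking_energy S G z u \<le> tracking_energy S G z ?w"
      using min by (auto simp: is_arg_min_def not_less)
    moreover have "tracking_energy S G z u = ereal (\<phi> 0 + a)"
      by (simp add: tracking_energy_def \<phi>_def ab)
    ultimately have "ereal (\<phi> 0 + a) \<le> ereal (\<phi> t + ((1 - t) * a + t * b))"
      by (metis order_trans)
    then have "t * (a - b) \<le> \<phi> t - \<phi> 0" by (simp add: algebra_simps)
    then show ?thesis using t by (simp add: field_simps)
  qed
  have "((\<lambda>t. S (u + t *\<^sub>R (v - u))) has_derivative (\<lambda>t. S' (t *\<^sub>R (v - u)))) (at 0)"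
    by (rule has_derivative_compose[where g = S and f = "\<lambda>t. u + t *\<^sub>R (v - u)"])
      (auto intro!: derivative_eq_intros S)
  then have "(\<phi> has_derivative (\<lambda>t. (S u - z) \<bullet> S' (t *\<^sub>R (v - u)))) (at 0)"
    unfolding \<phi>_def power2_norm_eq_inner
    by (auto intro!: derivative_eq_intros simp: inner_commute)
  moreover have "S' (t *\<^sub>R (v - u)) = t *\<^sub>R S' (v - u)" for t
    using has_derivative_linear[OF S] by (simp add: linear_cmul)
  ultimately have "(\<phi> has_field_derivative ((S u - z) \<bullet> S' (v - u))) (at 0)"
    by (simp add: has_field_derivative_def mult.commute[of _ "(S u - z) \<bullet> S' (v - u)"])
  then have "((\<lambda>t. (\<phi> t - \<phi> 0) / t) \<longlongrightarrow> (S u - z) \<bullet> S' (v - u)) (at 0)"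
    unfolding DERIV_def by simp
  then have "((\<lambda>t. (\<phi> t - \<phi> 0) / t) \<longlongrightarrow> (S u - z) \<bullet> S' (v - u)) (at_right 0)"
    by (rule filterlim_mono) (auto simp: at_le)
  then have "a - b \<le> (S u - z) \<bullet> S' (v - u)"
    by (rule tendsto_lowerbound)
      (auto intro!: eventually_at_rightI[of 0 1] lower)
  then show ?thesis by (simp add: ab inner_diff_left)
qed simp

text \<open>
  The hypothesis says that the supremum defining \<open>conjugate F p\<close> is attained at \<open>u\<close>, whereas for
  every other \<open>q\<close> the point \<open>u\<close> still gives a lower bound for \<open>conjugate F q\<close>.
\<close>

lemma subgradient_imp_conjugate_subgradient:
  assumes sub: "\<And>v. F u + ereal (p \<bullet> (v - u)) \<le> F v" and fin: "\<bar>F u\<bar> \<noteq> \<infinity>"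
  shows "u \<in> subdifferential (conjugate F) p"
proof -
  obtain a where a: "F u = ereal a" using fin by (cases "F u") auto
  have lower: "ereal (q \<bullet> u - a) \<le> conjugate F q" for q
    unfolding conjugate_def by (rule SUP_upper2[of u]) (auto simp: a)
  have "conjugate F p \<le> ereal (p \<bullet> u - a)"
    unfolding conjugate_def
  proof (rule SUP_least)
    fix v show "ereal (p \<bullet> v) - F v \<le> ereal (p \<bullet> u - a)"
      using sub[of v] by (cases "F v") (auto simp: a inner_diff_right)
  qed
  with lower[of p] have eq: "conjugate F p = ereal (p \<bullet> u - a)" by (rule antisym[rotated])
  have "conjugate F p + ereal (u \<bullet> (q - p)) \<le> conjugate F q" for q
    using lower[of q] unfolding eq by (simp add: inner_diff_right inner_commute)
  then show ?thesis by (simp add: subdifferential_def eq)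
qed

theorem corollary3p3:
  fixes \<Omega> :: "(real ^ 'n) set"
    and rep :: "'u::{real_inner, complete_space} \<Rightarrow> real ^ 'n \<Rightarrow> real ^ 'm"
    and M :: "(real ^ 'm) set"
    and g :: "real ^ 'm \<Rightarrow> ereal"
    and S :: "'u \<Rightarrow> 'y::{real_inner, complete_space}"
    and S' :: "'u \<Rightarrow> 'u \<Rightarrow> 'y"
    and j :: "'u \<Rightarrow> 'v::banach"
    and z :: 'y and zs :: "nat \<Rightarrow> 'y"
    and us :: "nat \<Rightarrow> 'u" and ys :: "nat \<Rightarrow> 'y" and ps :: "nat \<Rightarrow> 'u"
  defines "G \<equiv> integral_functional \<Omega> rep g"
  assumes domain: "open \<Omega>" "connected \<Omega>" "bounded \<Omega>" "\<Omega> \<noteq> {}"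
    and m_ge_2: "CARD('m) \<ge> 2"
    and U_is_L2: "is_L2_space \<Omega> rep"
    and M_finite: "finite M"
    and g: "proper_fun g" "convex_fun g" "lower_semicontinuous g"
    and dom_g: "effective_domain g = convex hull M"
    and zs_tendsto: "zs \<longlonglongrightarrow> z"
    and S_weakly_continuous:
      "\<And>X u. weakly_tendsto X u \<Longrightarrow> weakly_tendsto (\<lambda>i. S (X i)) (S u)"
    and S_differentiable: "\<And>u. (S has_derivative S' u) (at u)"
    and S_compact: "compact_operator S"
    and U_embeds_V: "continuous_embedding j"
    and V_dual_embeds: "dual_embeds_in_Linf \<Omega> rep j"
    and adjoint_in_dual: "\<And>u y. adjoint (S' u) y \<in> dual_space j"
    and adjoint_tendsto:
      "\<And>X u y. weakly_tendsto X u \<Longrightarrow>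
         (\<lambda>i. dual_norm j (adjoint (\<lambda>h. S' (X i) h - S' u h) y)) \<longlonglongrightarrow> 0"
    and us_minimizer: "\<And>n. is_minimizer (tracking_energy S G (zs n)) (us n)"
    and ys_def: "\<And>n. ys n = S (us n)"
    and ps_def: "\<And>n. ps n = adjoint (S' (us n)) (zs n - ys n)"
  shows "\<exists>r ubar ybar pbar.
           strict_mono (r :: nat \<Rightarrow> nat) \<and>
           weakly_tendsto (us \<circ> r) ubar \<and>
           (ys \<circ> r) \<longlonglongrightarrow> ybar \<and>
           tendsto_in_dual j (ps \<circ> r) pbar \<and>
           is_minimizer (tracking_energy S G z) ubar \<and>
           ybar = S ubar \<and>
           - pbar = adjoint (S' ubar) (S ubar - z) \<and>
           ubar \<in> subdifferential (conjugate G) pbar"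
proof -
  have lmeas: "\<Omega> \<in> lmeasurable" using domain by (intro lmeasurable_open)
  have compact_K: "compact (convex hull M)"
    by (intro compact_convex_hull finite_imp_compact M_finite)
  obtain C where C: "0 \<le> C" "\<And>x. ereal (- C) \<le> g x"
    using lower_semicontinuous_bounded_below[OF g(3) _ compact_K dom_g] g(1)
    unfolding proper_fun_def by blast
  interpret convex_integrand \<Omega> rep g C
    by unfold_locales (fact lmeas U_is_L2 g C)+
  have G_convex: "convex_fun G"
    unfolding G_def by (rule convex_integral_functional)
  have G_closed: "closed {u. G u \<le> a}" for a
    unfolding G_def by (rule closed_sublevel_integral_functional)
  have G_gt: "G u \<noteq> -\<infinity>" for u
    unfolding G_def using integral_functional_gt[of u] by auto
  obtain m where "g m < \<infinity>" using g(1) unfolding proper_fun_def by auto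
  then obtain u0 where u0: "G u0 < \<infinity>"
    unfolding G_def by (rule integral_functional_finite_at_const)
  have "bounded (effective_domain g)"
    unfolding dom_g using compact_K by (rule compact_imp_bounded)
  then obtain R where R: "\<And>u. G u < \<infinity> \<Longrightarrow> norm u \<le> R"
    unfolding G_def using bounded_effective_domain_integral_functional by blast
  have finite_at_minimizer: "G u < \<infinity>" if "is_minimizer (tracking_energy S G y) u" for u y
  proof -
    have "tracking_energy S G y u \<le> tracking_energy S G y u0"
      using that by (auto simp: is_arg_min_def not_less)
    also have "\<dots> < \<infinity>" using u0 by (simp add: tracking_energy_def)
    finally show ?thesis by (auto simp: tracking_energy_def)
  qed
  have us_bounded: "norm (us n) \<le> R" for n
    by (rule R[OF finite_at_minimizer[OF us_minimizer]])
  obtain r0 y where r0: "strict_mono r0" and y: "(\<lambda>n. S (us (r0 n))) \<longlonglongrightarrow> y"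
    by (rule compact_operator_bounded_subseq[OF S_compact, of us])
      (use us_bounded in \<open>auto simp: bounded_iff\<close>)
  obtain u r1 where r1: "strict_mono r1" and u: "weakly_tendsto (us \<circ> r0 \<circ> r1) u"
    by (rule bounded_imp_weakly_convergent_subseq[of "us \<circ> r0" R]) (use us_bounded in auto)
  \<comment> \<open>\<open>r0\<close> makes the states converge strongly, \<open>r1\<close> then makes the controls converge weakly\<close>
  define r where "r = r0 \<circ> r1"
  have r: "strict_mono r" unfolding r_def using r0 r1 by (rule strict_mono_o)
  have u_weak: "weakly_tendsto (us \<circ> r) u" using u by (simp add: r_def o_assoc)
  have "(\<lambda>n. S (us (r n))) \<longlonglongrightarrow> y"
    using LIMSEQ_subseq_LIMSEQ[OF y r1] by (simp add: r_def o_def)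
  moreover from this have "y = S u"
    using S_weakly_continuous[OF u_weak] by (intro tendsto_weakly_tendsto_unique) (auto simp: o_def)
  ultimately have Su: "(\<lambda>n. S (us (r n))) \<longlonglongrightarrow> S u" by simp
  have zr: "(\<lambda>n. zs (r n)) \<longlonglongrightarrow> z"
    using LIMSEQ_subseq_LIMSEQ[OF zs_tendsto r] by (simp add: o_def)
  have "G u \<le> liminf (\<lambda>n. G (us (r n)))"
    using convex_closed_sublevels_weakly_lsc[OF G_convex G_closed u_weak] by simp
  then have u_min: "is_minimizer (tracking_energy S G z) u"
    by (rule minimizer_of_limit_problem[OF us_minimizer zr Su])
  define p where "p = adjoint (S' u) (z - S u)"
  have S'_bl: "bounded_linear (S' v)" for v
    using S_differentiable by (rule has_derivative_bounded_linear)
  have "tendsto_in_dual j (\<lambda>n. adjoint (S' (us (r n))) (zs (r n) - S (us (r n)))) p"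
    unfolding p_def
  proof (rule tendsto_in_dual_adjoint)
    show "bounded_linear j" using U_embeds_V by (simp add: continuous_embedding_def)
    show "inj (dual_embedding j)" using V_dual_embeds by (simp add: dual_embeds_in_Linf_def)
    show "(\<lambda>n. zs (r n) - S (us (r n))) \<longlonglongrightarrow> z - S u"
      by (intro tendsto_diff zr Su)
    show "(\<lambda>n. dual_norm j (adjoint (\<lambda>h. S' (us (r n)) h - S' u h) y)) \<longlonglongrightarrow> 0" for y
      using adjoint_tendsto[OF u_weak] by simp
  qed (fact S'_bl adjoint_in_dual)+
  moreover have "ps \<circ> r = (\<lambda>n. adjoint (S' (us (r n))) (zs (r n) - S (us (r n))))"
    by (auto simp: ps_def ys_def)
  ultimately have p_lim: "tendsto_in_dual j (ps \<circ> r) p" by simp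
  have p_eq: "- p = adjoint (S' u) (S u - z)"
  proof -
    have "(- p) \<bullet> x = adjoint (S' u) (S u - z) \<bullet> x" for x
      by (simp add: p_def adjoint_characterization[OF S'_bl] inner_diff_left)
    then show ?thesis by (metis vector_eq_rdot)
  qed
  have "G u + ereal (p \<bullet> (v - u)) \<le> G v" for v
    unfolding p_def adjoint_characterization[OF S'_bl]
    by (rule tracking_minimizer_variational_inequality[OF u_min G_convex G_gt
          finite_at_minimizer[OF u_min] S_differentiable])
  moreover have "\<bar>G u\<bar> \<noteq> \<infinity>" using G_gt[of u] finite_at_minimizer[OF u_min] by auto
  ultimately have "u \<in> subdifferential (conjugate G) p"
    by (rule subgradient_imp_conjugate_subgradient)
  moreover have "(ys \<circ> r) \<longlonglongrightarrow> S u" using Su by (simp add: ys_def o_def)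
  ultimately show ?thesis
    using r u_weak p_lim u_min p_eq by blast
qed

end
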